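(* Let $\mathcal{S}$ be a nonempty set with a scene space basis $\mathcal{B}$. Let $P,Q$ be programs over $\mathcal{S}$ and $F:\mathcal{S}\to\{\text{true},\text{false}\}$ a formula such that $Q$ does not interfere with $F$. Then $[P]F \implies [P\parallel Q]F$; that is, for every state $s\in\mathcal{S}$, if $([P]F)(s)$ holds then $([P\parallel Q]F)(s)$ holds.
   Context: Scenes. Let $\mathcal{S}$ be a nonempty set (of states). A scene on $\mathcal{S}$ is a function $A:\mathcal{S}\to\mathcal{S}\to\mathcal{S}$, also written $\mathrm{mrg}_A$, satisfying for all $x,y,z$: $A\,(A\,x\,y)\,z = A\,x\,z$, $A\,x\,(A\,y\,z)=A\,x\,z$, $A\,x\,x=x$. Write $\bot = (\lambda s_1\,s_2.\ s_1)$, $\top=(\lambda s_1\,s_2.\ s_2)$, $A^{\complement}=(\lambda s_1\,s_2.\ A\,s_2\,s_1)$, $A\sqcup B=(\lambda s_1\,s_2.\ B\,(A\,s_1\,s_2)\,s_2)$. Scenes $A,B$ are independent if $B\,(A\,s_1\,s_2)\,s_3=A\,(B\,s_1\,s_3)\,s_2$ for all $s_1,s_2,s_3$. Write "$s_1\approx s_2$ on $A$" for $A\,s_1\,s_2=s_1$. A scene space basis is a finite sequence of scenes $S_1,\dots,S_n$ with $S_i,S_j$ independent for $i\neq j$ and $S_1\sqcup\cdots\sqcup S_n=\top$; $\mathcal{B}=\{S_1,\dots,S_n\}$. For a set $X\subseteq\mathcal{B}$, $\bigcup X$ denotes the $\sqcup$ of all its elements (in any order, the result being independent of it), with $\bigcup\emptyset=\bot$.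 A program is a binary predicate $P(s,s')$ on $\mathcal{S}$. A formula is a Boolean-valued function on $\mathcal{S}$. $FV(F)=\{x\in\mathcal{B} : \exists s,s'.\ s\approx s' \text{ on } x^{\complement} \text{ and } F(s)\ne F(s')\}$. $BV(P)=\{x\in\mathcal{B} : \exists s_0,s_0'.\ P(s_0,s_0') \text{ and not } (s_0\approx s_0' \text{ on } x)\}$. Program $P$ does not interfere with formula $F$ if $BV(P)\cap FV(F)=\emptyset$. Box: $([P]F)(s)$ holds iff $F(s')$ holds for all $s'$ with $P(s,s')$. Parallel composition: $(P\parallel Q)(s,s')$ iff there exist $s_P,s_Q\in\mathcal{S}$ with $P(s,s_P)$, $Q(s,s_Q)$ and $s'=\mathrm{mrg}_{\bigcup BV(P)}\,s_Q\,s_P$. *)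

theory Defs
  imports Main
begin

type_synonym 's scene = "'s \<Rightarrow> 's \<Rightarrow> 's"
type_synonym 's program = "'s \<Rightarrow> 's \<Rightarrow> bool"
type_synonym 's formula = "'s \<Rightarrow> bool"

text \<open>\<^term>\<open>A s t\<close> is the state obtained from \<open>s\<close> by overwriting the region
  selected by \<open>A\<close> with the contents of \<open>t\<close>.\<close>

definition is_scene :: "'s scene \<Rightarrow> bool" where
  "is_scene A \<longleftrightarrow>
     (\<forall>x y z. A (A x y) z = A x z) \<and> (\<forall>x y z. A x (A y z) = A x z) \<and> (\<forall>x. A x x = x)"

definition scene_bot :: "'s scene" where
  "scene_bot = (\<lambda>s1 s2. s1)"

definition scene_top :: "'s scene" where
  "scene_top = (\<lambda>s1 s2. s2)"

definition scene_compl :: "'s scene \<Rightarrow> 's scene" where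
  "scene_compl A = (\<lambda>s1 s2. A s2 s1)"

definition scene_join :: "'s scene \<Rightarrow> 's scene \<Rightarrow> 's scene" where
  "scene_join A B = (\<lambda>s1 s2. B (A s1 s2) s2)"

definition scene_indep :: "'s scene \<Rightarrow> 's scene \<Rightarrow> bool" where
  "scene_indep A B \<longleftrightarrow> (\<forall>s1 s2 s3. B (A s1 s2) s3 = A (B s1 s3) s2)"

definition agree_on :: "'s scene \<Rightarrow> 's \<Rightarrow> 's \<Rightarrow> bool" where
  "agree_on A s1 s2 \<longleftrightarrow> A s1 s2 = s1"

text \<open>A basis is a list, not a set: independence is required of any two distinct positions,
  so a scene occurring twice is independent of itself (and hence \<^const>\<open>scene_bot\<close>).\<close>

definition scene_space_basis :: "'s scene list \<Rightarrow> bool" where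
  "scene_space_basis Ss \<longleftrightarrow>
     (\<forall>S\<in>set Ss. is_scene S) \<and>
     (\<forall>i<length Ss. \<forall>j<length Ss. i \<noteq> j \<longrightarrow> scene_indep (Ss ! i) (Ss ! j)) \<and>
     foldr scene_join Ss scene_bot = scene_top"

definition scene_Union :: "'s scene set \<Rightarrow> 's scene" where
  "scene_Union X = Finite_Set.fold scene_join scene_bot X"

definition FV :: "'s scene set \<Rightarrow> 's formula \<Rightarrow> 's scene set" where
  "FV \<B> F = {x \<in> \<B>. \<exists>s s'. agree_on (scene_compl x) s s' \<and> F s \<noteq> F s'}"

definition BV :: "'s scene set \<Rightarrow> 's program \<Rightarrow> 's scene set" where
  "BV \<B> P = {x \<in> \<B>. \<exists>s0 s0'. P s0 s0' \<and> \<not> agree_on x s0 s0'}"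

definition non_interfering :: "'s scene set \<Rightarrow> 's program \<Rightarrow> 's formula \<Rightarrow> bool" where
  "non_interfering \<B> P F \<longleftrightarrow> BV \<B> P \<inter> FV \<B> F = {}"

definition box :: "'s program \<Rightarrow> 's formula \<Rightarrow> 's formula" where
  "box P F = (\<lambda>s. \<forall>s'. P s s' \<longrightarrow> F s')"

definition par :: "'s scene set \<Rightarrow> 's program \<Rightarrow> 's program \<Rightarrow> 's program" where
  "par \<B> P Q = (\<lambda>s s'. \<exists>sP sQ. P s sP \<and> Q s sQ \<and> s' = scene_Union (BV \<B> P) sQ sP)"

text \<open>On subsets of a basis, \<^const>\<open>scene_Union\<close> is the join of the elements
  taken in any order.\<close>

lemma scene_space_basis_indep:
  assumes "scene_space_basis Ss" "x \<in> set Ss" "y \<in> set Ss" "x \<noteq> y"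
  shows "scene_indep x y"
  using assms unfolding scene_space_basis_def by (metis in_set_conv_nth)

lemma scene_Union_set:
  assumes "scene_space_basis Ss" "set xs \<subseteq> set Ss" "distinct xs"
  shows "scene_Union (set xs) = foldr scene_join xs scene_bot"
proof -
  have comm: "scene_join y (scene_join x Z) = scene_join x (scene_join y Z)"
    if "x \<in> set Ss" "y \<in> set Ss" for x y Z
  proof (cases "x = y")
    case False
    then show ?thesis
      using scene_space_basis_indep[OF assms(1) that]
      by (simp add: scene_join_def scene_indep_def)
  qed simp
  interpret comp_fun_commute_on "set Ss" scene_join
    by standard (rule ext, simp only: o_apply, rule comm)
  show ?thesis
    using assms(2,3) unfolding scene_Union_def by (induction xs) auto
qed

end

theory Submission imports Defs begin

text \<open>On every basis scene bound by \<open>P\<close> or not bound by \<open>Q\<close>, the merged state agrees with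
  the result of \<open>P\<close>; so the two states differ only on scenes bound by \<open>Q\<close>, none of which is
  free in \<open>F\<close>. As the basis joins to the top scene, the merged state can be rewritten into the
  result of \<open>P\<close> one basis scene at a time: each step is either vacuous or takes place on a scene
  that is not free in \<open>F\<close>, so it keeps the truth value of \<open>F\<close>.\<close>

lemma scene_space_basis_scene:
  assumes "scene_space_basis Ss" "x \<in> set Ss"
  shows "is_scene x"
  using assms by (simp add: scene_space_basis_def)

text \<open>\<open>x t\<close> sees only the \<open>x\<close>-part of its second argument, so
  \<open>u\<close> can be replaced by \<open>x s u\<close>, which is \<open>s\<close>, and then by
  \<open>t\<close>. The common state \<open>s\<close> comes first in both premises, as it does for a
  start state in \<open>BV\<close>.\<close>

lemma agree_on_trans:
  assumes "is_scene x" "agree_on x s t" "agree_on x s u"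
  shows "agree_on x t u"
proof -
  have "x t u = x t (x s u)" "x t (x s t) = x t t" "x t t = t"
    using assms(1) by (simp_all add: is_scene_def)
  then show ?thesis
    using assms(2,3) by (simp add: agree_on_def)
qed

lemma agree_on_overwrite_self:
  assumes "is_scene x"
  shows "agree_on x (x u t) t"
  using assms by (simp add: agree_on_def is_scene_def)

text \<open>For distinct scenes, independence turns \<open>x (y u t) t\<close> into
  \<open>y (x u t) t\<close>, and \<open>x u t\<close> is \<open>u\<close>. Thus overwriting from
  \<open>t\<close> never destroys agreement with \<open>t\<close>.\<close>

lemma agree_on_overwrite:
  assumes "scene_space_basis Ss" "x \<in> set Ss" "y \<in> set Ss" "agree_on x u t"
  shows "agree_on x (y u t) t"
proof (cases "x = y")
  case True
  then show ?thesis
    using scene_space_basis_scene[OF assms(1,2)] by (simp add: agree_on_overwrite_self)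
next
  case False
  then show ?thesis
    using scene_space_basis_indep[OF assms(1-3)] assms(4)
    unfolding scene_indep_def agree_on_def by metis
qed

lemma agree_on_foldr_join:
  assumes "scene_space_basis Ss" "x \<in> set Ss" "set ys \<subseteq> set Ss"
    and "agree_on x u t \<or> x \<in> set ys"
  shows "agree_on x (foldr scene_join ys scene_bot u t) t"
  using assms(3,4)
proof (induction ys arbitrary: u)
  case Nil
  then show ?case by (simp add: scene_bot_def)
next
  case (Cons y ys)
  \<comment> \<open>The head \<open>y\<close> of the join acts first: agreement already present
    survives it, and if \<open>y\<close> is \<open>x\<close> it is created here.\<close>
  have "agree_on x (y u t) t \<or> x \<in> set ys"
    using Cons.prems agree_on_overwrite[OF assms(1,2)]
      agree_on_overwrite_self[OF scene_space_basis_scene[OF assms(1,2)]] by auto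
  with Cons show ?case by (simp add: scene_join_def)
qed

lemma agree_on_scene_Union:
  assumes "scene_space_basis Ss" "x \<in> set Ss" "X \<subseteq> set Ss" "agree_on x u t \<or> x \<in> X"
  shows "agree_on x (scene_Union X u t) t"
proof -
  \<comment> \<open>A distinct enumeration turns the fold over a set into a
    \<open>foldr\<close>.\<close>
  obtain ys where "set ys = X" "distinct ys"
    using finite_distinct_list[of X] finite_subset[OF assms(3)] by auto
  then show ?thesis
    using agree_on_foldr_join[of Ss x ys] scene_Union_set[of Ss ys] assms by auto
qed

lemma overwrite_not_FV:
  assumes "is_scene x" "x \<in> \<B>" "x \<notin> FV \<B> F"
  shows "F (x u t) = F u"
proof -
  have "agree_on (scene_compl x) u (x u t)"
    using assms(1) by (simp add: agree_on_def scene_compl_def is_scene_def)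
  then show ?thesis
    using assms(2,3) by (auto simp: FV_def)
qed

lemma foldr_join_agree_on_FV:
  assumes "scene_space_basis Ss" "set xs \<subseteq> set Ss"
    and "\<And>x. x \<in> FV (set Ss) F \<Longrightarrow> agree_on x u t"
  shows "F (foldr scene_join xs scene_bot u t) = F u"
  using assms(2,3)
proof (induction xs arbitrary: u)
  case Nil
  then show ?case by (simp add: scene_bot_def)
next
  case (Cons x xs)
  have x: "x \<in> set Ss" using Cons.prems(1) by simp
  have "agree_on z (x u t) t" if "z \<in> FV (set Ss) F" for z
    using agree_on_overwrite[OF assms(1) _ x] Cons.prems(2)[OF that] that by (simp add: FV_def)
  then have "F (foldr scene_join xs scene_bot (x u t) t) = F (x u t)"
    using Cons by simp
  \<comment> \<open>If \<open>x\<close> is free in \<open>F\<close>, agreement gives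
    \<open>x u t = u\<close>; otherwise \<open>F\<close> ignores the change.\<close>
  also have "F (x u t) = F u"
    using overwrite_not_FV[OF scene_space_basis_scene[OF assms(1) x] x] Cons.prems(2)
    by (metis agree_on_def)
  finally show ?case by (simp add: scene_join_def[of x])
qed

text \<open>Joining the whole basis gives the top scene, which sends \<open>u\<close> to
  \<open>t\<close>.\<close>

lemma formula_eq_if_agree_on_FV:
  assumes "scene_space_basis Ss" "\<And>x. x \<in> FV (set Ss) F \<Longrightarrow> agree_on x u t"
  shows "F t = F u"
  using foldr_join_agree_on_FV[OF assms(1) order_refl assms(2)] assms(1)
  by (simp add: scene_space_basis_def scene_top_def)

theorem theorem47:
  fixes Ss :: "'s scene list" and P Q :: "'s program" and F :: "'s formula"
  assumes "scene_space_basis Ss"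
    and "non_interfering (set Ss) Q F"
  shows "\<forall>s. box P F s \<longrightarrow> box (par (set Ss) P Q) F s"
proof -
  have "F (scene_Union (BV (set Ss) P) sQ sP)" if "P s sP" "Q s sQ" "F sP" for s sP sQ
  proof -
    have "agree_on x (scene_Union (BV (set Ss) P) sQ sP) sP" if x: "x \<in> FV (set Ss) F" for x
    proof (rule agree_on_scene_Union[OF assms(1)])
      show xS: "x \<in> set Ss" using x by (simp add: FV_def)
      show "BV (set Ss) P \<subseteq> set Ss" by (auto simp: BV_def)
      \<comment> \<open>By non-interference, \<open>x\<close> is not bound by
        \<open>Q\<close>.\<close>
      have "agree_on x s sQ"
        using assms(2) x xS \<open>Q s sQ\<close> by (auto simp: non_interfering_def BV_def)
      moreover have "agree_on x s sP \<or> x \<in> BV (set Ss) P"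
        using xS \<open>P s sP\<close> by (auto simp: BV_def)
      \<comment> \<open>If \<open>P\<close> does not bind \<open>x\<close> either, both results
        agree on \<open>x\<close> with the start state \<open>s\<close>, hence with each
        other.\<close>
      ultimately show "agree_on x sQ sP \<or> x \<in> BV (set Ss) P"
        using agree_on_trans[OF scene_space_basis_scene[OF assms(1) xS]] by blast
    qed
    then have "F sP = F (scene_Union (BV (set Ss) P) sQ sP)"
      by (rule formula_eq_if_agree_on_FV[OF assms(1)])
    then show ?thesis
      using \<open>F sP\<close> by simp
  qed
  then show ?thesis by (auto simp: box_def par_def)
qed

end
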